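(* Consider the rate function of the probability of false selection, $$-\lim_{n\to\infty}\frac1n\log PFS=\min\Big\{\min_{i\in S_o,\,i\ne m}R_{m,i}(\boldsymbol{\alpha}),\ \min_{j\in S_n}R_{m,j}(\boldsymbol{\alpha})\Big\},$$ with the allocation rule $$\alpha_r=\frac{|\rho_{mi^*,r}|}{|\rho_{mi^*,1}|+|\rho_{mi^*,s}|+|\rho_{mi^*,t}|}\ \ (r=1,s,t),\qquad \alpha_r=0\ \text{otherwise},$$ where $i^*$ is the key design, $i^*=\arg\min_{i=1,\dots,t}\{\min_{i\in S_o,i\ne m}R_{m,i}(\boldsymbol{\alpha}),\min_{i\in S_n}R_{m,i}(\boldsymbol{\alpha})\}$. This rate function is maximized (with respect to the location of the support design $s$) if the support design $s$ satisfies $$x_s=\begin{cases}x_{i^*}+x_m-x_1,&\frac{3x_1+x_t}{4}\le\frac{x_{i^*}+x_m}{2}<\frac{x_1+x_t}{2},\\[2pt] x_{i^*}+x_m-x_t,&\frac{x_1+x_t}{2}<\frac{x_{i^*}+x_m}{2}\le\frac{x_1+3x_t}{4},\\[2pt] (x_1+x_t)/2,&\text{otherwise.}\end{cases}$$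
   Context: There are $t$ designs at real locations $x_1<x_2<\dots<x_t$, with mean performances $f(x_i)=\beta_0+\beta_1x_i+\beta_2x_i^2$. $S_o$ is the set of the $m$ designs with smallest means, $S_n$ its complement, $\max_{i\in S_o}f(x_i)<\min_{j\in S_n}f(x_j)$; $m$ also denotes the design with the $m$-th smallest mean. Simulation noise is independent $N(0,\sigma^2)$. Three support designs $1,s,t$ (with $x_1<x_s<x_t$) are simulated, receiving proportions $\boldsymbol{\alpha}=(\alpha_1,\alpha_s,\alpha_t)$ of the total budget $n$, and $\hat f$ is the quadratic ordinary least squares estimate of $f$. $PFS=1-PCS$, where $PCS=P\{\bigcap_{i\in S_o}\bigcap_{j\in S_n}\hat f(x_i)\le\hat f(x_j)\}$. For $i,j\in\{1,\dots,t\}$ put $$\rho_{ij,1}=\tfrac{(x_s-x_i)(x_t-x_i)-(x_s-x_j)(x_t-x_j)}{(x_1-x_s)(x_1-x_t)},\quad \rho_{ij,s}=\tfrac{(x_1-x_i)(x_t-x_i)-(x_1-x_j)(x_t-x_j)}{(x_s-x_1)(x_s-x_t)},\quad \rho_{ij,t}=\tfrac{(x_1-x_i)(x_s-x_i)-(x_1-x_j)(x_s-x_j)}{(x_t-x_1)(x_t-x_s)},$$ and for $i\ne m$ $$R_{m,i}(\boldsymbol{\alpha})=\frac{(f(x_m)-f(x_i))^2/2}{\sigma^2\big(\rho_{mi,1}^2/\alpha_1+\rho_{mi,s}^2/\alpha_s+\rho_{mi,t}^2/\alpha_t\big)},$$ the exponential decay rate in $n$ of the probability of incorrectly comparing designs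 $i$ and $m$ (a term $0/0$ is read as $0$). The key design $i^*$ is the design with the minimum such rate. When the value $x_s$ given by the formula is not the location of an available design, it is rounded to the nearest one. *)

theory Defs
  imports "HOL-Probability.Probability"
begin

type_synonym coeffs = "real \<times> real \<times> real"

definition quad :: "coeffs \<Rightarrow> real \<Rightarrow> real" where
  "quad b z = (case b of (b0, b1, b2) \<Rightarrow> b0 + b1 * z + b2 * z\<^sup>2)"

text \<open>
  The designs are \<open>1, \<dots>, ndes P\<close>; \<open>best P\<close> is the set of the (\<open>card (best P)\<close> many)
  designs with smallest means and \<open>mdes P\<close> is the design whose mean is the
  \<open>card (best P)\<close>-th smallest, i.e. one of largest mean within \<open>best P\<close>.
\<close>

record selection_problem =
  ndes :: nat
  loc :: "nat \<Rightarrow> real"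
  beta :: coeffs
  noise_sd :: real
  best :: "nat set"
  mdes :: nat

definition mean :: "selection_problem \<Rightarrow> nat \<Rightarrow> real" where
  "mean P i = quad (beta P) (loc P i)"

definition rest :: "selection_problem \<Rightarrow> nat set" where
  "rest P = {1..ndes P} - best P"

definition valid_problem :: "selection_problem \<Rightarrow> bool" where
  "valid_problem P \<longleftrightarrow>
     3 \<le> ndes P \<and> strict_mono_on {1..ndes P} (loc P) \<and> 0 < noise_sd P \<and>
     best P \<subseteq> {1..ndes P} \<and> best P \<noteq> {} \<and> rest P \<noteq> {} \<and>
     (\<forall>i\<in>best P. \<forall>j\<in>rest P. mean P i < mean P j) \<and>
     mdes P \<in> best P \<and> (\<forall>i\<in>best P. mean P i \<le> mean P (mdes P))"

text \<open>
  The support designs are the first and last designs and a middle one. The location \<open>y\<close> of the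
  middle one is the decision variable; it ranges over the whole open interval between the
  extreme locations and is not restricted to the grid of available designs.
\<close>

datatype support = First | Mid | Last

definition admissible :: "selection_problem \<Rightarrow> real \<Rightarrow> bool" where
  "admissible P y \<longleftrightarrow> loc P 1 < y \<and> y < loc P (ndes P)"

fun support_loc :: "selection_problem \<Rightarrow> real \<Rightarrow> support \<Rightarrow> real" where
  "support_loc P y First = loc P 1"
| "support_loc P y Mid = y"
| "support_loc P y Last = loc P (ndes P)"

fun rho :: "selection_problem \<Rightarrow> real \<Rightarrow> nat \<Rightarrow> nat \<Rightarrow> support \<Rightarrow> real" where
  "rho P y i j First =
     ((y - loc P i) * (loc P (ndes P) - loc P i) - (y - loc P j) * (loc P (ndes P) - loc P j))
     / ((loc P 1 - y) * (loc P 1 - loc P (ndes P)))"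
| "rho P y i j Mid =
     ((loc P 1 - loc P i) * (loc P (ndes P) - loc P i)
        - (loc P 1 - loc P j) * (loc P (ndes P) - loc P j))
     / ((y - loc P 1) * (y - loc P (ndes P)))"
| "rho P y i j Last =
     ((loc P 1 - loc P i) * (y - loc P i) - (loc P 1 - loc P j) * (y - loc P j))
     / ((loc P (ndes P) - loc P 1) * (loc P (ndes P) - y))"

text \<open>
  Divisions are in \<^typ>\<open>ereal\<close>, where \<open>0 / 0 = 0\<close>, \<open>c / 0 = \<infinity>\<close> for \<open>c > 0\<close>, and \<open>c / \<infinity> = 0\<close> for
  real \<open>c\<close>. So a support design with no budget contributes nothing to the variance of a
  comparison that does not use it, and makes the decay rate of any other comparison \<open>0\<close>.
\<close>

definition pair_rate :: "selection_problem \<Rightarrow> real \<Rightarrow> (support \<Rightarrow> real) \<Rightarrow> nat \<Rightarrow> ereal" where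
  "pair_rate P y \<alpha> i =
     ereal ((mean P (mdes P) - mean P i)\<^sup>2 / 2) /
     (ereal ((noise_sd P)\<^sup>2) *
       (ereal ((rho P y (mdes P) i First)\<^sup>2) / ereal (\<alpha> First)
        + ereal ((rho P y (mdes P) i Mid)\<^sup>2) / ereal (\<alpha> Mid)
        + ereal ((rho P y (mdes P) i Last)\<^sup>2) / ereal (\<alpha> Last)))"

text \<open>An empty inner minimum (\<open>best P = {mdes P}\<close>) is \<open>\<infinity>\<close>.\<close>

definition rate :: "selection_problem \<Rightarrow> real \<Rightarrow> (support \<Rightarrow> real) \<Rightarrow> ereal" where
  "rate P y \<alpha> = min (INF i\<in>best P - {mdes P}. pair_rate P y \<alpha> i)
                    (INF j\<in>rest P. pair_rate P y \<alpha> j)"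

definition key_design :: "selection_problem \<Rightarrow> real \<Rightarrow> (support \<Rightarrow> real) \<Rightarrow> nat \<Rightarrow> bool" where
  "key_design P y \<alpha> i \<longleftrightarrow>
     is_arg_min (pair_rate P y \<alpha>) (\<lambda>k. k \<in> (best P - {mdes P}) \<union> rest P) i"

definition alloc :: "selection_problem \<Rightarrow> nat \<Rightarrow> real \<Rightarrow> support \<Rightarrow> real" where
  "alloc P i y r = \<bar>rho P y (mdes P) i r\<bar> /
     (\<bar>rho P y (mdes P) i First\<bar> + \<bar>rho P y (mdes P) i Mid\<bar> + \<bar>rho P y (mdes P) i Last\<bar>)"

definition opt_loc :: "selection_problem \<Rightarrow> nat \<Rightarrow> real" where
  "opt_loc P i =
     (let x1 = loc P 1; xt = loc P (ndes P); xi = loc P i; xm = loc P (mdes P) in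
      if (3 * x1 + xt) / 4 \<le> (xi + xm) / 2 \<and> (xi + xm) / 2 < (x1 + xt) / 2 then xi + xm - x1
      else if (x1 + xt) / 2 < (xi + xm) / 2 \<and> (xi + xm) / 2 \<le> (x1 + 3 * xt) / 4 then xi + xm - xt
      else (x1 + xt) / 2)"

text \<open>\<open>\<epsilon> r k\<close> is the noise in the \<open>k\<close>-th simulation run of the support design \<open>r\<close>.\<close>

definition noise_model ::
    "selection_problem \<Rightarrow> 'w measure \<Rightarrow> (support \<Rightarrow> nat \<Rightarrow> 'w \<Rightarrow> real) \<Rightarrow> bool" where
  "noise_model P M \<epsilon> \<longleftrightarrow>
     prob_space M \<and>
     prob_space.indep_vars M (\<lambda>_. borel) (\<lambda>(r, k). \<epsilon> r k) UNIV \<and>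
     (\<forall>r k. distributed M lborel (\<epsilon> r k) (normal_density 0 (noise_sd P)))"

text \<open>
  With total budget \<open>n\<close>, support design \<open>r\<close> receives \<open>\<lfloor>\<alpha> r * n\<rfloor>\<close> runs. The least squares fit is
  unique only if all three support designs are run, so the estimator \<open>b n\<close> is any
  random vector minimizing the sum of squared residuals.
\<close>

definition rss ::
    "selection_problem \<Rightarrow> (support \<Rightarrow> nat \<Rightarrow> 'w \<Rightarrow> real) \<Rightarrow> real \<Rightarrow> (support \<Rightarrow> real) \<Rightarrow>
     nat \<Rightarrow> 'w \<Rightarrow> coeffs \<Rightarrow> real" where
  "rss P \<epsilon> y \<alpha> n w c =
     (\<Sum>r\<in>{First, Mid, Last}. \<Sum>k<nat \<lfloor>\<alpha> r * real n\<rfloor>.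
        ((quad (beta P) (support_loc P y r) + \<epsilon> r k w) - quad c (support_loc P y r))\<^sup>2)"

definition ols_estimator ::
    "selection_problem \<Rightarrow> 'w measure \<Rightarrow> (support \<Rightarrow> nat \<Rightarrow> 'w \<Rightarrow> real) \<Rightarrow> real \<Rightarrow>
     (support \<Rightarrow> real) \<Rightarrow> (nat \<Rightarrow> 'w \<Rightarrow> coeffs) \<Rightarrow> bool" where
  "ols_estimator P M \<epsilon> y \<alpha> b \<longleftrightarrow>
     (\<forall>n. b n \<in> borel_measurable M \<and>
        (\<forall>w\<in>space M. is_arg_min (rss P \<epsilon> y \<alpha> n w) (\<lambda>_. True) (b n w)))"

definition pcs :: "selection_problem \<Rightarrow> 'w measure \<Rightarrow> ('w \<Rightarrow> coeffs) \<Rightarrow> real" where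
  "pcs P M c = \<P>(w in M. \<forall>i\<in>best P. \<forall>j\<in>rest P. quad (c w) (loc P i) \<le> quad (c w) (loc P j))"

definition pfs :: "selection_problem \<Rightarrow> 'w measure \<Rightarrow> ('w \<Rightarrow> coeffs) \<Rightarrow> real" where
  "pfs P M c = 1 - pcs P M c"

definition pfs_exponent ::
    "selection_problem \<Rightarrow> 'w measure \<Rightarrow> (nat \<Rightarrow> 'w \<Rightarrow> coeffs) \<Rightarrow> nat \<Rightarrow> ereal" where
  "pfs_exponent P M b n = ereal (- (1 / real n) * ln (pfs P M (b n)))"

text \<open>
  The formula for the decay rate of the probability of false selection. It is stated as a
  property of a configuration and not proved: comparisons of \<open>mdes P\<close> with the other members of
  \<open>best P\<close> enter \<^const>\<open>rate\<close> but not the event of correct selection, so the formula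
  does not hold for every problem.
\<close>

definition pfs_rate_formula ::
    "selection_problem \<Rightarrow> 'w measure \<Rightarrow> real \<Rightarrow> (support \<Rightarrow> real) \<Rightarrow>
     (nat \<Rightarrow> 'w \<Rightarrow> coeffs) \<Rightarrow> bool" where
  "pfs_rate_formula P M y \<alpha> b \<longleftrightarrow> (pfs_exponent P M b \<longlonglongrightarrow> rate P y \<alpha>)"

end

theory Submission imports Defs begin

text \<open>
  Write \<open>a < c\<close> for the two extreme locations, \<open>y\<close> for the middle support location and \<open>u\<close> for the
  midpoint of \<open>x\<^sub>m\<close> and \<open>x\<^sub>i\<close>. Every quadratic \<open>g\<close> satisfies \<open>g x\<^sub>m - g x\<^sub>i = (x\<^sub>m - x\<^sub>i) g' u\<close>, so comparing
  design \<open>i\<close> with design \<open>m\<close> amounts to estimating the slope at \<open>u\<close>. The numbers \<open>\<rho>\<^sub>r\<close> are the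
  coefficients with which Lagrange interpolation expresses \<open>g x\<^sub>m - g x\<^sub>i\<close> through the values of \<open>g\<close>
  at the support locations.

  For fixed \<open>y\<close>, the tangent line inequality \<open>\<rho>\<^sup>2 / \<alpha> \<ge> 2 S \<bar>\<rho>\<bar> - S\<^sup>2 \<alpha>\<close> with \<open>S = \<Sum> \<bar>\<rho>\<^sub>r\<bar>\<close>, summed over the
  support, gives \<open>\<Sum> \<rho>\<^sub>r\<^sup>2 / \<alpha>\<^sub>r \<ge> S\<^sup>2\<close>, with equality for \<open>\<alpha>\<^sub>r = \<bar>\<rho>\<^sub>r\<bar> / S\<close>. Hence the decay rate for the
  pair \<open>(m, i)\<close> is at most \<open>(f x\<^sub>m - f x\<^sub>i)\<^sup>2 / (2 \<sigma>\<^sup>2 S\<^sup>2)\<close> under every allocation and equals it under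
  the one tuned to \<open>i\<close> (\<open>pair_rate_le\<close>, \<open>pair_rate_alloc\<close>). It remains to make \<open>S\<close> small.

  Here \<open>S = \<bar>x\<^sub>m - x\<^sub>i\<bar> N y\<close>, where \<open>N y\<close> is the norm of the functional \<open>g \<mapsto> g' u\<close> on quadratics normed
  by their largest absolute value at \<open>a\<close>, \<open>y\<close>, \<open>c\<close>. A quadratic bounded by \<open>1\<close> on the whole of
  \<open>[a, c]\<close> therefore bounds \<open>N y\<close> from below by \<open>\<bar>g' u\<bar>\<close> for all \<open>y\<close> at once (\<open>slope_le_slope_norm\<close>).
  This bound is attained at the claimed location, with the following \<open>g\<close>. For \<open>u\<close> in an outer
  quarter of \<open>[a, c]\<close> take the Chebyshev polynomial \<open>T\<^sub>2\<close> rescaled to \<open>[a, c]\<close>, whose extrema are the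
  ends and the centre. For \<open>u\<close> left of the centre but not in the outer quarter take the parabola
  with value \<open>1\<close> at \<open>a\<close> and minimum \<open>-1\<close> at \<open>2 u - a\<close>; the location \<open>2 u - a\<close> makes the coefficient
  at \<open>c\<close> vanish. Right of the centre reflect, and at the centre take the affine map from \<open>[a, c]\<close>
  onto \<open>[-1, 1]\<close> (\<open>slope_norm_opt\<close>).

  Since \<^const>\<open>rate\<close> is a minimum over all competitors of \<open>m\<close>, it never exceeds the rate of the pair
  \<open>(m, i)\<close>, whichever design the allocation is tuned to; the latter is bounded by its optimum over
  all \<open>y\<close>. If \<open>i\<close> is the key design at the optimal location, \<^const>\<open>rate\<close> reaches this bound there.
\<close>

section \<open>The norm of the slope functional on three nodes\<close>

definition slope_norm :: "real \<Rightarrow> real \<Rightarrow> real \<Rightarrow> real \<Rightarrow> real" where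
  "slope_norm a c u y =
     \<bar>2 * u - y - c\<bar> / ((y - a) * (c - a)) + \<bar>2 * u - a - c\<bar> / ((y - a) * (c - y))
       + \<bar>2 * u - a - y\<bar> / ((c - a) * (c - y))"

text \<open>
  Differentiating the Lagrange interpolation formula at \<open>u\<close> writes the slope of \<^const>\<open>quad\<close> as a
  combination of the values at the nodes; \<^const>\<open>slope_norm\<close> is the sum of the absolute values of
  the coefficients.
\<close>

lemma slope_le_slope_norm:
  assumes "a < y" "y < c"
    and "\<bar>quad (b0, b1, b2) a\<bar> \<le> 1" "\<bar>quad (b0, b1, b2) y\<bar> \<le> 1" "\<bar>quad (b0, b1, b2) c\<bar> \<le> 1"
  shows "\<bar>b1 + 2 * b2 * u\<bar> \<le> slope_norm a c u y"
proof -
  let ?g = "quad (b0, b1, b2)"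
  define A B C where "A = (2 * u - y - c) / ((y - a) * (c - a))"
    and "B = - (2 * u - a - c) / ((y - a) * (c - y))"
    and "C = (2 * u - a - y) / ((c - a) * (c - y))"
  have pos: "y - a > 0" "c - y > 0" "c - a > 0" using assms by auto
  have "b1 + 2 * b2 * u = A * ?g a + B * ?g y + C * ?g c"
  proof -
    define D where "D = (y - a) * (c - a) * (c - y)"
    have coeffs: "A * D = (2 * u - y - c) * (c - y)" "B * D = - (2 * u - a - c) * (c - a)"
      "C * D = (2 * u - a - y) * (y - a)"
      using pos by (simp_all add: A_def B_def C_def D_def)
    have "(A * ?g a + B * ?g y + C * ?g c) * D
        = (A * D) * ?g a + (B * D) * ?g y + (C * D) * ?g c"
      by algebra
    also have "\<dots> = (b1 + 2 * b2 * u) * D"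
      unfolding coeffs unfolding quad_def D_def prod.case by algebra
    finally have "(A * ?g a + B * ?g y + C * ?g c) * D = (b1 + 2 * b2 * u) * D" .
    moreover have "D \<noteq> 0" using pos by (simp add: D_def)
    ultimately have "A * ?g a + B * ?g y + C * ?g c = b1 + 2 * b2 * u" by simp
    thus ?thesis by simp
  qed
  also have "\<bar>\<dots>\<bar> \<le> \<bar>A * ?g a\<bar> + \<bar>B * ?g y\<bar> + \<bar>C * ?g c\<bar>" by linarith
  also have "\<dots> \<le> \<bar>A\<bar> + \<bar>B\<bar> + \<bar>C\<bar>"
    unfolding abs_mult using assms by (intro add_mono mult_left_le) auto
  also have "\<dots> = slope_norm a c u y"
    using pos unfolding A_def B_def C_def slope_norm_def
    by (simp add: abs_mult abs_minus_commute)
  finally show ?thesis .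
qed

text \<open>The quadratic in use is \<open>k (z - v)\<^sup>2 - 1\<close>, which has its minimum \<open>-1\<close> at \<open>v\<close>.\<close>

lemma parabola_slope_le_slope_norm:
  assumes "a < y" "y < c" "0 \<le> k" and "\<And>z. a \<le> z \<Longrightarrow> z \<le> c \<Longrightarrow> k * (z - v)\<^sup>2 \<le> 2"
  shows "2 * k * \<bar>u - v\<bar> \<le> slope_norm a c u y"
proof -
  have eq: "quad (k * v\<^sup>2 - 1, - 2 * k * v, k) z = k * (z - v)\<^sup>2 - 1" for z
    by (simp add: quad_def power2_eq_square algebra_simps)
  have bound: "\<bar>quad (k * v\<^sup>2 - 1, - 2 * k * v, k) z\<bar> \<le> 1" if "a \<le> z" "z \<le> c" for z
    using assms(4)[OF that] \<open>0 \<le> k\<close> unfolding eq by (simp add: abs_le_iff)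
  have "\<bar>- 2 * k * v + 2 * k * u\<bar> \<le> slope_norm a c u y"
    using assms by (intro slope_le_slope_norm[where ?b0.0 = "k * v\<^sup>2 - 1"] bound) auto
  moreover have "- 2 * k * v + 2 * k * u = 2 * k * (u - v)" by (simp add: algebra_simps)
  ultimately show ?thesis using \<open>0 \<le> k\<close> by (simp add: abs_mult)
qed

lemma slope_norm_ge_affine:
  assumes "a < y" "y < c"
  shows "2 / (c - a) \<le> slope_norm a c u y"
proof -
  have eq: "quad (- (a + c) / (c - a), 2 / (c - a), 0) z = (2 * z - a - c) / (c - a)" for z
    by (simp add: quad_def diff_divide_distrib add_divide_distrib)
  have bound: "\<bar>quad (- (a + c) / (c - a), 2 / (c - a), 0) z\<bar> \<le> 1" if "a \<le> z" "z \<le> c" for z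
    unfolding eq using that assms by (simp add: abs_le_iff field_simps)
  have "\<bar>2 / (c - a) + 2 * 0 * u\<bar> \<le> slope_norm a c u y"
    by (rule slope_le_slope_norm; (rule assms bound)?) (use assms in auto)
  thus ?thesis using assms by simp
qed

lemma slope_norm_pos: "a < y \<Longrightarrow> y < c \<Longrightarrow> 0 < slope_norm a c u y"
  using slope_norm_ge_affine[of a y c u]
  by (meson diff_gt_0_iff_gt divide_pos_pos less_le_trans less_trans zero_less_numeral)

lemma slope_norm_reflect: "slope_norm (- c) (- a) (- u) (- y) = slope_norm a c u y"
proof -
  have "2 * - u - - y - - a = - (2 * u - a - y)" "2 * - u - - c - - a = - (2 * u - a - c)"
    "2 * - u - - c - - y = - (2 * u - y - c)"
    "- y - - c = c - y" "- a - - c = c - a" "- a - - y = y - a"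
    by simp_all
  thus ?thesis unfolding slope_norm_def
    by (simp only: abs_minus_cancel mult.commute add.commute add.left_commute)
qed

section \<open>The optimal middle node\<close>

text \<open>
  The lower bound comes from the parabola \<open>2 (z - v)\<^sup>2 / (v - a)\<^sup>2 - 1\<close> with \<open>v = 2 u - a\<close>. It is bounded
  by \<open>1\<close> at \<open>c\<close> exactly when \<open>c - v \<le> v - a\<close>, which is where the condition \<open>(3 a + c) / 4 \<le> u\<close> comes
  from.
\<close>

lemma slope_norm_opt_inner:
  assumes "a < y" "y < c" "(3 * a + c) / 4 \<le> u" "u < (a + c) / 2"
  shows "slope_norm a c u (2 * u - a) \<le> slope_norm a c u y"
proof -
  define v where "v = 2 * u - a"
  have v: "a < v" "v < c" "c - v \<le> v - a" and u: "u = (a + v) / 2"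
    using assms by (auto simp: v_def field_simps)
  have "2 / (v - a)\<^sup>2 * (z - v)\<^sup>2 \<le> 2" if "a \<le> z" "z \<le> c" for z
  proof -
    have "\<bar>z - v\<bar> \<le> v - a" using that v by linarith
    hence "(z - v)\<^sup>2 \<le> (v - a)\<^sup>2" using abs_le_square_iff[of "z - v" "v - a"] by simp
    thus ?thesis using v by (simp add: divide_le_eq)
  qed
  hence "2 * (2 / (v - a)\<^sup>2) * \<bar>u - v\<bar> \<le> slope_norm a c u y"
    using assms by (intro parabola_slope_le_slope_norm) auto
  moreover have "\<bar>u - v\<bar> = (v - a) / 2" using v by (simp add: u abs_if field_simps)
  moreover have "2 * (2 / d\<^sup>2) * (d / 2) = 2 / d" for d :: real
    by (simp add: power2_eq_square)
  ultimately have "2 / (v - a) \<le> slope_norm a c u y" by metis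
  moreover have "slope_norm a c u v = 2 / (v - a)"
  proof -
    have coeffs: "\<bar>2 * u - v - c\<bar> = c - a" "\<bar>2 * u - a - c\<bar> = c - v" "\<bar>2 * u - a - v\<bar> = 0"
      using v by (auto simp: v_def)
    show ?thesis unfolding slope_norm_def coeffs using v by simp
  qed
  ultimately show ?thesis by (simp add: v_def)
qed

text \<open>
  The lower bound comes from the second Chebyshev polynomial, rescaled to \<open>[a, c]\<close>. It alternates
  between \<open>1\<close> and \<open>-1\<close> at the nodes \<open>a\<close>, \<open>(a + c) / 2\<close>, \<open>c\<close>, and the coefficients of the slope
  functional alternate in sign along with it as long as \<open>2 u \<le> a + (a + c) / 2\<close>, which is the
  hypothesis on \<open>u\<close>.
\<close>

lemma slope_norm_opt_outer:
  assumes "a < y" "y < c" "u \<le> (3 * a + c) / 4"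
  shows "slope_norm a c u ((a + c) / 2) \<le> slope_norm a c u y"
proof -
  define h l where "h = (a + c) / 2" and "l = (c - a) / 2"
  have ac: "a = h - l" "c = h + l" and l: "l > 0" and u: "2 * u \<le> 2 * h - l"
    using assms by (auto simp: h_def l_def field_simps)
  have "2 / l\<^sup>2 * (z - h)\<^sup>2 \<le> 2" if "a \<le> z" "z \<le> c" for z
  proof -
    have "\<bar>z - h\<bar> \<le> l" using that ac by linarith
    hence "(z - h)\<^sup>2 \<le> l\<^sup>2" using abs_le_square_iff[of "z - h" l] by simp
    thus ?thesis using l by (simp add: divide_le_eq)
  qed
  hence "2 * (2 / l\<^sup>2) * \<bar>u - h\<bar> \<le> slope_norm a c u y"
    using assms by (intro parabola_slope_le_slope_norm) auto
  moreover have "slope_norm a c u h = 2 * (2 / l\<^sup>2) * \<bar>u - h\<bar>"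
  proof -
    have "\<bar>2 * u - h - c\<bar> = 2 * h + l - 2 * u" "\<bar>2 * u - a - c\<bar> = 2 * h - 2 * u"
         "\<bar>2 * u - a - h\<bar> = 2 * h - l - 2 * u" "\<bar>u - h\<bar> = h - u"
      using u l by (auto simp: ac abs_if)
    moreover have "h - a = l" "c - h = l" "c - a = 2 * l" by (auto simp: ac)
    ultimately show ?thesis
      unfolding slope_norm_def using l by (simp add: power2_eq_square field_simps)
  qed
  ultimately show ?thesis by (simp add: h_def)
qed

lemma slope_norm_opt_centre:
  assumes "a < y" "y < c"
  shows "slope_norm a c ((a + c) / 2) ((a + c) / 2) \<le> slope_norm a c ((a + c) / 2) y"
proof -
  define h l where "h = (a + c) / 2" and "l = (c - a) / 2"
  have ac: "a = h - l" "c = h + l" and l: "l > 0"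
    using assms by (auto simp: h_def l_def field_simps)
  have "slope_norm a c h h = 2 / (c - a)"
    unfolding slope_norm_def ac using l by (simp add: abs_if)
  thus ?thesis using slope_norm_ge_affine[OF assms] by (simp add: h_def)
qed

definition opt_node :: "real \<Rightarrow> real \<Rightarrow> real \<Rightarrow> real" where
  "opt_node a c u =
     (if (3 * a + c) / 4 \<le> u \<and> u < (a + c) / 2 then 2 * u - a
      else if (a + c) / 2 < u \<and> u \<le> (a + 3 * c) / 4 then 2 * u - c
      else (a + c) / 2)"

lemma opt_node_between:
  assumes "a < c"
  shows "a < opt_node a c u" "opt_node a c u < c"
  using assms by (auto simp: opt_node_def field_simps)

lemma slope_norm_opt:
  assumes "a < y" "y < c"
  shows "slope_norm a c u (opt_node a c u) \<le> slope_norm a c u y"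
proof -
  have refl: "- c < - y" "- y < - a" using assms by auto
  consider "u < (3 * a + c) / 4" | "(3 * a + c) / 4 \<le> u" "u < (a + c) / 2" | "u = (a + c) / 2"
    | "(a + c) / 2 < u" "u \<le> (a + 3 * c) / 4" | "(a + 3 * c) / 4 < u"
    by linarith
  thus ?thesis
  proof cases
    case 1
    hence "opt_node a c u = (a + c) / 2" using assms by (auto simp: opt_node_def field_simps)
    thus ?thesis using slope_norm_opt_outer[OF assms, of u] 1 by (simp only: less_imp_le)
  next
    case 2
    thus ?thesis using slope_norm_opt_inner[OF assms] by (simp add: opt_node_def)
  next
    case 3
    thus ?thesis using slope_norm_opt_centre[OF assms] unfolding 3 by (simp add: opt_node_def)
  next
    case 4
    have "slope_norm (- c) (- a) (- u) (2 * (- u) - - c) \<le> slope_norm (- c) (- a) (- u) (- y)"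
      using 4 by (intro slope_norm_opt_inner[OF refl]) (auto simp: field_simps)
    moreover have "2 * (- u) - - c = - opt_node a c u" using 4 by (simp add: opt_node_def)
    ultimately show ?thesis by (metis slope_norm_reflect)
  next
    case 5
    have "slope_norm (- c) (- a) (- u) ((- c + - a) / 2) \<le> slope_norm (- c) (- a) (- u) (- y)"
      using 5 by (intro slope_norm_opt_outer[OF refl]) (auto simp: field_simps)
    moreover have "(- c + - a) / 2 = - opt_node a c u"
      using 5 assms by (auto simp: opt_node_def field_simps)
    ultimately show ?thesis by (metis slope_norm_reflect)
  qed
qed

section \<open>The coefficients of a pairwise comparison\<close>

definition rho_sum :: "selection_problem \<Rightarrow> real \<Rightarrow> nat \<Rightarrow> real" where
  "rho_sum P y i =
     \<bar>rho P y (mdes P) i First\<bar> + \<bar>rho P y (mdes P) i Mid\<bar> + \<bar>rho P y (mdes P) i Last\<bar>"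

lemma rho_sum_eq_slope_norm:
  assumes "admissible P y"
  shows "rho_sum P y i = \<bar>loc P (mdes P) - loc P i\<bar> *
           slope_norm (loc P 1) (loc P (ndes P)) ((loc P i + loc P (mdes P)) / 2) y"
proof -
  define a c p q where "a = loc P 1" and "c = loc P (ndes P)"
    and "p = loc P (mdes P)" and "q = loc P i"
  have pos: "y - a > 0" "c - y > 0" "c - a > 0"
    using assms by (auto simp: admissible_def a_def c_def)
  have den: "\<bar>(a - y) * (a - c)\<bar> = (y - a) * (c - a)" "\<bar>(y - a) * (y - c)\<bar> = (y - a) * (c - y)"
    "\<bar>(c - a) * (c - y)\<bar> = (c - a) * (c - y)"
    using pos by (simp_all add: abs_mult)
  have num: "(y - p) * (c - p) - (y - q) * (c - q) = (p - q) * (q + p - y - c)"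
    "(a - p) * (c - p) - (a - q) * (c - q) = (p - q) * (q + p - a - c)"
    "(a - p) * (y - p) - (a - q) * (y - q) = (p - q) * (q + p - a - y)"
    by (simp_all add: algebra_simps)
  have mid: "2 * ((q + p) / 2) = q + p" by simp
  show ?thesis
    unfolding rho_sum_def slope_norm_def rho.simps a_def[symmetric] c_def[symmetric]
      p_def[symmetric] q_def[symmetric] num abs_divide den mid
    unfolding abs_mult by (simp only: distrib_left times_divide_eq_right)
qed

lemma loc_first_less_last:
  assumes "valid_problem P"
  shows "loc P 1 < loc P (ndes P)"
  using assms unfolding valid_problem_def by (auto intro: strict_mono_onD)

lemma opt_loc_eq_opt_node:
  "opt_loc P i = opt_node (loc P 1) (loc P (ndes P)) ((loc P i + loc P (mdes P)) / 2)"
  by (simp add: opt_loc_def opt_node_def Let_def)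

lemma admissible_opt_loc:
  assumes "valid_problem P"
  shows "admissible P (opt_loc P i)"
  using opt_node_between[OF loc_first_less_last[OF assms]]
  unfolding admissible_def opt_loc_eq_opt_node by blast

lemma rho_sum_pos:
  assumes "valid_problem P" "i \<in> {1..ndes P}" "i \<noteq> mdes P" "admissible P y"
  shows "0 < rho_sum P y i"
proof -
  have "inj_on (loc P) {1..ndes P}" "mdes P \<in> {1..ndes P}"
    using assms(1) strict_mono_on_imp_inj_on unfolding valid_problem_def by auto
  hence "loc P (mdes P) \<noteq> loc P i" using assms(2,3) by (metis inj_onD)
  thus ?thesis
    using assms(4) slope_norm_pos by (simp add: rho_sum_eq_slope_norm admissible_def)
qed

lemma rho_sum_opt_loc_le:
  assumes "valid_problem P" "admissible P y"
  shows "rho_sum P (opt_loc P i) i \<le> rho_sum P y i"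
  using assms admissible_opt_loc[OF assms(1), of i]
  by (auto simp: rho_sum_eq_slope_norm admissible_def opt_loc_eq_opt_node
      intro!: mult_left_mono slope_norm_opt)

section \<open>The decay rate of a pairwise comparison\<close>

lemma alloc_nonneg: "0 \<le> alloc P k y r"
  by (simp add: alloc_def)

lemma alloc_sum_le_1: "alloc P k y First + alloc P k y Mid + alloc P k y Last \<le> 1"
  unfolding alloc_def add_divide_distrib[symmetric] divide_self_if by simp

text \<open>
  The bound is the tangent to \<open>\<rho>\<^sup>2 / \<alpha>\<close>, as a function of \<open>\<alpha>\<close>, at \<open>\<alpha> = \<bar>\<rho>\<bar> / S\<close>. In the extended reals
  it also covers an unused support design: there the quotient is \<open>0\<close> or \<open>\<infinity>\<close>.
\<close>

lemma tangent_le_variance_term: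
  assumes "0 \<le> \<alpha>"
  shows "ereal (2 * S * \<bar>\<rho>\<bar> - S\<^sup>2 * \<alpha>) \<le> ereal (\<rho>\<^sup>2) / ereal \<alpha>"
proof (cases "\<alpha> = 0")
  case True
  thus ?thesis by (cases "\<rho> = 0") (simp_all add: divide_ereal_def)
next
  case False
  hence pos: "\<alpha> > 0" using assms by simp
  have "0 \<le> (\<bar>\<rho>\<bar> - S * \<alpha>)\<^sup>2" by simp
  hence "(2 * S * \<bar>\<rho>\<bar> - S\<^sup>2 * \<alpha>) * \<alpha> \<le> \<rho>\<^sup>2"
    by (simp add: power2_eq_square algebra_simps)
  thus ?thesis using pos by (simp add: le_divide_eq)
qed

definition comparison_variance ::
    "selection_problem \<Rightarrow> real \<Rightarrow> (support \<Rightarrow> real) \<Rightarrow> nat \<Rightarrow> ereal" where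
  "comparison_variance P y \<alpha> i =
     ereal ((rho P y (mdes P) i First)\<^sup>2) / ereal (\<alpha> First)
     + ereal ((rho P y (mdes P) i Mid)\<^sup>2) / ereal (\<alpha> Mid)
     + ereal ((rho P y (mdes P) i Last)\<^sup>2) / ereal (\<alpha> Last)"

lemma comparison_variance_ge:
  assumes "\<And>r. 0 \<le> \<alpha> r" and "\<alpha> First + \<alpha> Mid + \<alpha> Last \<le> 1"
  shows "ereal ((rho_sum P y i)\<^sup>2) \<le> comparison_variance P y \<alpha> i"
proof -
  define S where "S = rho_sum P y i"
  let ?t = "\<lambda>r. 2 * S * \<bar>rho P y (mdes P) i r\<bar> - S\<^sup>2 * \<alpha> r"
  have "?t First + ?t Mid + ?t Last = 2 * S * S - S\<^sup>2 * (\<alpha> First + \<alpha> Mid + \<alpha> Last)"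
    by (simp add: S_def rho_sum_def algebra_simps)
  moreover have "S\<^sup>2 * (\<alpha> First + \<alpha> Mid + \<alpha> Last) \<le> S\<^sup>2 * 1"
    using assms(2) by (intro mult_left_mono) auto
  ultimately have "S\<^sup>2 \<le> ?t First + ?t Mid + ?t Last"
    by (simp add: power2_eq_square)
  hence "ereal (S\<^sup>2) \<le> ereal (?t First) + ereal (?t Mid) + ereal (?t Last)" by simp
  also have "\<dots> \<le> comparison_variance P y \<alpha> i"
    unfolding comparison_variance_def
    by (intro add_mono tangent_le_variance_term assms(1))
  finally show ?thesis by (simp add: S_def)
qed

lemma comparison_variance_alloc:
  assumes "0 < rho_sum P y i"
  shows "comparison_variance P y (alloc P i y) i = ereal ((rho_sum P y i)\<^sup>2)"
proof -
  define S where "S = rho_sum P y i"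
  have S: "S > 0" using assms by (simp add: S_def)
  have terms: "ereal ((rho P y (mdes P) i r)\<^sup>2) / ereal (alloc P i y r)
      = ereal (S * \<bar>rho P y (mdes P) i r\<bar>)" for r
  proof -
    have al: "alloc P i y r = \<bar>rho P y (mdes P) i r\<bar> / S"
      by (simp add: alloc_def S_def rho_sum_def)
    have sq: "(rho P y (mdes P) i r)\<^sup>2 = \<bar>rho P y (mdes P) i r\<bar>\<^sup>2" by simp
    have "ereal (z\<^sup>2) / ereal (z / S) = ereal (S * z)" for z
      using S by (cases "z = 0") (simp_all add: power2_eq_square divide_ereal_def)
    thus ?thesis unfolding al sq .
  qed
  have "comparison_variance P y (alloc P i y) i
      = ereal (S * (\<bar>rho P y (mdes P) i First\<bar> + \<bar>rho P y (mdes P) i Mid\<bar>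
          + \<bar>rho P y (mdes P) i Last\<bar>))"
    unfolding comparison_variance_def terms by (simp only: plus_ereal.simps distrib_left)
  thus ?thesis by (simp add: S_def rho_sum_def power2_eq_square)
qed

definition best_pair_rate :: "selection_problem \<Rightarrow> real \<Rightarrow> nat \<Rightarrow> real" where
  "best_pair_rate P y i =
     (mean P (mdes P) - mean P i)\<^sup>2 / 2 / ((noise_sd P)\<^sup>2 * (rho_sum P y i)\<^sup>2)"

lemma pair_rate_eq_variance:
  "pair_rate P y \<alpha> i = ereal ((mean P (mdes P) - mean P i)\<^sup>2 / 2) /
     (ereal ((noise_sd P)\<^sup>2) * comparison_variance P y \<alpha> i)"
  by (simp add: pair_rate_def comparison_variance_def)

lemma pair_rate_alloc:
  assumes "0 < rho_sum P y i" "0 < noise_sd P"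
  shows "pair_rate P y (alloc P i y) i = ereal (best_pair_rate P y i)"
  unfolding pair_rate_eq_variance comparison_variance_alloc[OF assms(1)] best_pair_rate_def
  using assms by simp

lemma ereal_divide_antimono:
  assumes "0 \<le> n" "0 < d" "ereal d \<le> v"
  shows "ereal n / v \<le> ereal (n / d)"
  using assms by (cases v) (auto intro: divide_left_mono)

lemma pair_rate_le:
  assumes "0 < rho_sum P y i" "0 < noise_sd P"
    and "\<And>r. 0 \<le> \<alpha> r" "\<alpha> First + \<alpha> Mid + \<alpha> Last \<le> 1"
  shows "pair_rate P y \<alpha> i \<le> ereal (best_pair_rate P y i)"
  unfolding pair_rate_eq_variance best_pair_rate_def
proof (rule ereal_divide_antimono)
  have "ereal ((noise_sd P)\<^sup>2) * ereal ((rho_sum P y i)\<^sup>2)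
      \<le> ereal ((noise_sd P)\<^sup>2) * comparison_variance P y \<alpha> i"
    using comparison_variance_ge[OF assms(3,4)] by (intro ereal_mult_left_mono) auto
  thus "ereal ((noise_sd P)\<^sup>2 * (rho_sum P y i)\<^sup>2)
      \<le> ereal ((noise_sd P)\<^sup>2) * comparison_variance P y \<alpha> i" by simp
qed (use assms in auto)

lemma best_pair_rate_le_opt_loc:
  assumes "valid_problem P" "i \<in> {1..ndes P}" "i \<noteq> mdes P" "admissible P y"
  shows "best_pair_rate P y i \<le> best_pair_rate P (opt_loc P i) i"
proof -
  have "0 < rho_sum P (opt_loc P i) i" "0 < noise_sd P"
    using assms rho_sum_pos admissible_opt_loc by (auto simp: valid_problem_def)
  thus ?thesis
    unfolding best_pair_rate_def using rho_sum_opt_loc_le[OF assms(1,4), of i]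
    by (intro divide_left_mono mult_left_mono power_mono mult_pos_pos) auto
qed

section \<open>The overall rate\<close>

lemma rate_eq_INF:
  "rate P y \<alpha> = (INF k\<in>(best P - {mdes P}) \<union> rest P. pair_rate P y \<alpha> k)"
  by (simp add: rate_def INF_union inf_min)

lemma rate_key_design:
  assumes "key_design P y \<alpha> i"
  shows "rate P y \<alpha> = pair_rate P y \<alpha> i"
  using assms unfolding rate_eq_INF key_design_def is_arg_min_linorder
  by (intro antisym INF_lower INF_greatest) auto

text \<open>The allocation may be tuned to a design \<open>k\<close> other than \<open>i\<close>.\<close>

lemma rate_alloc_le:
  assumes "valid_problem P" "i \<in> {1..ndes P}" "i \<noteq> mdes P" "admissible P y"
  shows "rate P y (alloc P k y) \<le> ereal (best_pair_rate P (opt_loc P i) i)"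
proof -
  have sd: "0 < noise_sd P" using assms(1) by (simp add: valid_problem_def)
  have "rate P y (alloc P k y) \<le> pair_rate P y (alloc P k y) i"
    unfolding rate_eq_INF using assms(2,3) by (intro INF_lower) (auto simp: rest_def)
  also have "\<dots> \<le> ereal (best_pair_rate P y i)"
    by (intro pair_rate_le rho_sum_pos assms sd alloc_nonneg alloc_sum_le_1)
  also have "\<dots> \<le> ereal (best_pair_rate P (opt_loc P i) i)"
    using best_pair_rate_le_opt_loc[OF assms] by simp
  finally show ?thesis .
qed

lemma lim_pfs_exponent: "pfs_rate_formula P M y \<alpha> b \<Longrightarrow> lim (pfs_exponent P M b) = rate P y \<alpha>"
  unfolding pfs_rate_formula_def by (rule limI)

theorem theorem2:
  fixes P :: selection_problem and i :: nat and xs :: real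
    and M :: "'w measure" and \<epsilon> :: "support \<Rightarrow> nat \<Rightarrow> 'w \<Rightarrow> real"
    and b :: "nat \<Rightarrow> real \<Rightarrow> nat \<Rightarrow> 'w \<Rightarrow> coeffs"
  assumes "valid_problem P"
    and "i \<in> {1..ndes P}" and "i \<noteq> mdes P"
    and "xs = opt_loc P i"
  shows
    "(\<forall>y. admissible P y \<and> key_design P y (alloc P i y) i \<longrightarrow>
          rate P y (alloc P i y) = pair_rate P y (alloc P i y) i) \<and>
     is_arg_max (\<lambda>y. pair_rate P y (alloc P i y) i) (admissible P) xs \<and>
     (\<forall>y k. admissible P y \<and> key_design P y (alloc P k y) k \<longrightarrow>
          rate P y (alloc P k y) \<le> pair_rate P xs (alloc P i xs) i) \<and>
     (key_design P xs (alloc P i xs) i \<longrightarrow>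
        is_arg_max (\<lambda>y. rate P y (alloc P i y)) (admissible P) xs \<and>
        (\<forall>y k. admissible P y \<and> key_design P y (alloc P k y) k \<longrightarrow>
           rate P y (alloc P k y) \<le> rate P xs (alloc P i xs)) \<and>
        (noise_model P M \<epsilon> \<and>
         (\<forall>k y. admissible P y \<longrightarrow> ols_estimator P M \<epsilon> y (alloc P k y) (b k y)) \<and>
         pfs_rate_formula P M xs (alloc P i xs) (b i xs) \<longrightarrow>
           (\<forall>y k. admissible P y \<and> key_design P y (alloc P k y) k \<and>
                  pfs_rate_formula P M y (alloc P k y) (b k y) \<longrightarrow>
              lim (pfs_exponent P M (b k y)) \<le> lim (pfs_exponent P M (b i xs)))))"
proof -
  have adm: "admissible P xs" using assms admissible_opt_loc by simp
  have pair_rate_i: "pair_rate P y (alloc P i y) i = ereal (best_pair_rate P y i)"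
    if "admissible P y" for y
    using assms that rho_sum_pos by (intro pair_rate_alloc) (auto simp: valid_problem_def)
  have le: "rate P y (alloc P k y) \<le> pair_rate P xs (alloc P i xs) i" if "admissible P y" for y k
    unfolding pair_rate_i[OF adm] using assms that rate_alloc_le by simp
  have "is_arg_max (\<lambda>y. pair_rate P y (alloc P i y) i) (admissible P) xs"
    unfolding is_arg_max_linorder
    using adm assms best_pair_rate_le_opt_loc by (auto simp: pair_rate_i)
  moreover have "is_arg_max (\<lambda>y. rate P y (alloc P i y)) (admissible P) xs \<and>
      (\<forall>y k. admissible P y \<and> key_design P y (alloc P k y) k \<longrightarrow>
         rate P y (alloc P k y) \<le> rate P xs (alloc P i xs)) \<and>
      (noise_model P M \<epsilon> \<and>
       (\<forall>k y. admissible P y \<longrightarrow> ols_estimator P M \<epsilon> y (alloc P k y) (b k y)) \<and>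
       pfs_rate_formula P M xs (alloc P i xs) (b i xs) \<longrightarrow>
         (\<forall>y k. admissible P y \<and> key_design P y (alloc P k y) k \<and>
                pfs_rate_formula P M y (alloc P k y) (b k y) \<longrightarrow>
            lim (pfs_exponent P M (b k y)) \<le> lim (pfs_exponent P M (b i xs))))"
    if "key_design P xs (alloc P i xs) i"
  proof -
    have le_rate: "rate P y (alloc P k y) \<le> rate P xs (alloc P i xs)"
      if "admissible P y" for y k
      using le[OF that] rate_key_design[OF \<open>key_design P xs (alloc P i xs) i\<close>] by simp
    show ?thesis
      unfolding is_arg_max_linorder using adm le_rate by (auto simp: lim_pfs_exponent)
  qed
  ultimately show ?thesis
    by (intro conjI allI impI) (auto simp: rate_key_design le)
qed

end
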